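(* Let $\mathcal{W}$ be a finite vocabulary and consider the Gumbel-max watermark model described in the context, with watermark fraction $\varepsilon_n \asymp n^{-p}$ for a constant $p$ with $\frac12 < p \le 1$. Suppose Assumption (A) of the context holds. Then $H_0$ and $H_1^{\mathrm{mix}}$ merge asymptotically, i.e. the total variation distance between the joint distribution of $(Y_1,\dots,Y_n)$ under $H_0$ and under $H_1^{\mathrm{mix}}$ tends to $0$ as $n\to\infty$. Consequently, for any test based on $Y_{1:n}$, the sum of its Type I and Type II errors tends to $1$ as $n \to \infty$.
   Context: Notation: $a_n \asymp b_n$ means there are constants $C_1, C_2>0$ with $C_1 a_n \le b_n \le C_2 a_n$ for all $n$. For a probability vector $\mathbf{P}=(P_w)_{w\in\mathcal{W}}$ on the finite set $\mathcal{W}$, let $\mu_{1,\mathbf{P}}$ be the distribution on $[0,1]$ with CDF $F_{1,\mathbf{P}}(r)=\sum_{w\in\mathcal{W}} P_w r^{1/P_w}$ (terms with $P_w=0$ are $0$) and density $f_{1,\mathbf{P}}(r)=\sum_{w:P_w>0} r^{1/P_w-1}$; let $\mu_0=U(0,1)$. Watermark model: for $t=1,\dots,n$, a (random) next-token distribution $\mathbf{P}_t$ on $\mathcal{W}$ is produced, a pseudorandom vector $\xi_t=(U_{t,w})_{w\in\mathcal{W}}$ with i.i.d. $U(0,1)$ entries is available, the Gumbel-max decoder is $\mathcal{S}(\mathbf{P},\xi)=\arg\max_{w} \frac{\log U_w}{P_w}$, the observed token is $w_t$, and the pivotal statistic is $Y_t=U_{t,w_t}$. Let $\mathcal{F}_{t-1}=\sigma(\{w_j,\xi_j,\mathbf{P}_{j+1}\}_{j=1}^{t-1})$.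 Assumption (A): (a) $\xi_1,\dots,\xi_n$ are i.i.d. and $\xi_t$ is independent of $\mathcal{F}_{t-1}$; (b) with probability $\varepsilon_n$, $w_t=\mathcal{S}(\mathbf{P}_t,\xi_t)$; otherwise $w_t$ is drawn from $\mathbf{P}_t$ and, conditionally on $\mathcal{F}_{t-1}$, is independent of $\xi_t$. $H_1^{\mathrm{mix}}$ denotes the joint law of $Y_{1:n}$ generated by this model (so that $Y_t$ given $\mathbf{P}_t$ follows $(1-\varepsilon_n)\mu_0+\varepsilon_n\mu_{1,\mathbf{P}_t}$), and $H_0$ denotes the law under which $Y_1,\dots,Y_n$ are i.i.d. $U(0,1)$. Type I error: probability of rejecting $H_0$ under $H_0$; Type II error: probability of not rejecting under $H_1^{\mathrm{mix}}$. *)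

theory Defs
  imports "HOL-Probability.Probability"
begin

(* Gumbel-max decoder S(P,xi) = argmax_w log U_w / P_w.  Tokens with P_w = 0
   have ratio -infinity (log U_w < 0), so the argmax ranges over the support of P. *)
definition gumbel_max :: "('w::finite \<Rightarrow> real) \<Rightarrow> ('w \<Rightarrow> real) \<Rightarrow> 'w" where
  "gumbel_max P U = arg_max_on (\<lambda>v. ln (U v) / P v) {v. P v > 0}"

definition prob_vector :: "('w::finite \<Rightarrow> real) \<Rightarrow> bool" where
  "prob_vector P \<longleftrightarrow> (\<forall>v. P v \<ge> 0) \<and> sum P UNIV = 1"

abbreviation vecM :: "('w::finite \<Rightarrow> real) measure" where
  "vecM \<equiv> PiM UNIV (\<lambda>_. borel)"

definition gen_sets :: "'a measure \<Rightarrow> ('a \<Rightarrow> 'b) \<Rightarrow> 'b measure \<Rightarrow> 'a set set" where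
  "gen_sets M X N = {X -` B \<inter> space M | B. B \<in> sets N}"

definition hist_sets ::
  "'a measure \<Rightarrow> (nat \<Rightarrow> 'a \<Rightarrow> 'w::finite \<Rightarrow> real) \<Rightarrow> (nat \<Rightarrow> 'a \<Rightarrow> 'w \<Rightarrow> real)
   \<Rightarrow> (nat \<Rightarrow> 'a \<Rightarrow> 'w) \<Rightarrow> nat \<Rightarrow> 'a set set" where
  "hist_sets M P xi w t = sigma_sets (space M)
     ((\<Union>j\<in>{1..t}. gen_sets M (P j) vecM)
      \<union> (\<Union>j\<in>{1..<t}. gen_sets M (xi j) vecM)
      \<union> (\<Union>j\<in>{1..<t}. gen_sets M (w j) (count_space UNIV)))"

(* Assumption (A) for the length-n model on the probability space M with watermark
   fraction eps.  Z t is the event "token t was produced by the Gumbel-max decoder". *)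
definition watermark_model ::
  "'a measure \<Rightarrow> nat \<Rightarrow> real \<Rightarrow> (nat \<Rightarrow> 'a \<Rightarrow> 'w::finite \<Rightarrow> real) \<Rightarrow> (nat \<Rightarrow> 'a \<Rightarrow> 'w \<Rightarrow> real)
   \<Rightarrow> (nat \<Rightarrow> 'a \<Rightarrow> 'w) \<Rightarrow> (nat \<Rightarrow> 'a \<Rightarrow> bool) \<Rightarrow> bool" where
  "watermark_model M n eps P xi w Z \<longleftrightarrow>
     prob_space M \<and>
     (\<forall>t\<in>{1..n}.
        P t \<in> measurable M vecM \<and>
        xi t \<in> measurable M vecM \<and>
        w t \<in> measurable M (count_space UNIV) \<and>
        {x \<in> space M. Z t x} \<in> sets M \<and>
        (\<forall>x\<in>space M. prob_vector (P t x)) \<and>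
        \<comment> \<open>(a) xi_t has i.i.d. U(0,1) entries and is independent of F_{t-1}\<close>
        distr M vecM (xi t) = PiM UNIV (\<lambda>_. uniform_measure lborel {0..1}) \<and>
        (\<forall>A\<in>hist_sets M P xi w t. \<forall>B\<in>sets vecM.
           measure M (A \<inter> xi t -` B) = measure M A * measure M (xi t -` B \<inter> space M)) \<and>
        \<comment> \<open>(b) the watermark indicator has probability eps and is independent of (F_{t-1}, xi_t)\<close>
        (\<forall>A\<in>hist_sets M P xi w t. \<forall>B\<in>sets vecM.
           measure M (A \<inter> xi t -` B \<inter> {x. Z t x}) = eps * measure M (A \<inter> xi t -` B)) \<and>
        \<comment> \<open>watermarked tokens are produced by the Gumbel-max decoder\<close>
        (AE x in M. Z t x \<longrightarrow> w t x = gumbel_max (P t x) (xi t x)) \<and>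
        \<comment> \<open>otherwise w_t is drawn from P_t, conditionally on F_{t-1} independent of xi_t\<close>
        (\<forall>A\<in>hist_sets M P xi w t. \<forall>B\<in>sets vecM. \<forall>v.
           measure M (A \<inter> xi t -` B \<inter> {x. \<not> Z t x} \<inter> {x. w t x = v}) =
           (\<integral>x. indicator (A \<inter> xi t -` B \<inter> {x. \<not> Z t x}) x * P t x v \<partial>M)))"

definition pivot_law ::
  "'a measure \<Rightarrow> nat \<Rightarrow> (nat \<Rightarrow> 'a \<Rightarrow> 'w \<Rightarrow> real) \<Rightarrow> (nat \<Rightarrow> 'a \<Rightarrow> 'w) \<Rightarrow> (nat \<Rightarrow> real) measure" where
  "pivot_law M n xi w = distr M (PiM {1..n} (\<lambda>_. borel)) (\<lambda>x. \<lambda>t\<in>{1..n}. xi t x (w t x))"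

definition null_law :: "nat \<Rightarrow> (nat \<Rightarrow> real) measure" where
  "null_law n = PiM {1..n} (\<lambda>_. uniform_measure lborel {0..1})"

definition tv_dist :: "'b measure \<Rightarrow> 'b measure \<Rightarrow> real" where
  "tv_dist M N = (SUP A \<in> sets M. \<bar>measure M A - measure N A\<bar>)"

end

theory Submission
  imports Defs
begin

text \<open>
  Test functions replace conditional likelihood ratios. Let \<open>U\<close> be uniform on \<open>[0,1]\<close>, let \<open>K\<close> be the size
  of the vocabulary, and split \<open>h(y,u) = m(y) + k(y,u)\<close> with \<open>m(y) = E h(y,U)\<close>. Given the past, an unmarked
  token contributes nothing to the expectation of \<open>k\<close>, while a marked one contributes at most
  \<open>\<epsilon> K E |k(y,U)|\<close>, because the pivot is one of the \<open>K\<close> uniform coordinates of \<open>\<xi>\<close>; no formula for the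
  Gumbel-max pivot law is needed. By Cauchy-Schwarz the conditional expectation of \<open>h\<close> is at most
  \<open>sqrt (1 + \<epsilon>\<^sup>2 K\<^sup>2) sqrt (E h(y,U)\<^sup>2)\<close>, and iterating over the \<open>n\<close> tokens gives
  \<open>E\<^sub>1 h \<le> (1 + \<epsilon>\<^sup>2 K\<^sup>2)\<^bsup>n/2\<^esup> sqrt (E\<^sub>0 h\<^sup>2)\<close>, a chi-square bound for the likelihood ratio in dual form.
  Testing with \<open>h = 1 + s (1\<^sub>A - H\<^sub>0 A)\<close> bounds the total variation distance by
  \<open>sqrt (exp (n \<epsilon>\<^sup>2 K\<^sup>2) - 1)\<close>, which vanishes since \<open>n \<epsilon>\<^sub>n\<^sup>2\<close> is of order \<open>n\<^bsup>1 - 2p\<^esup>\<close> and \<open>p > 1/2\<close>.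
\<close>

section \<open>A single token: expectations over the past and a fresh variable\<close>

text \<open>By \<open>rect\<close>, under the weight \<open>phi\<close> the pair formed by the past
  and \<open>V\<close> has a product law on rectangles. Rectangles determine a product of
  sigma-finite measures, so Fubini extends the identity to every bounded \<open>G\<close>. In the
  applications \<open>phi\<close> is the indicator of a marking event, \<open>V\<close> is a
  coordinate of \<open>xi t\<close>, and \<open>psi\<close> is the weight that this event has when
  seen from the past.\<close>

lemma integral_weighted_pair:
  fixes phi psi :: "'a \<Rightarrow> real" and G :: "'a \<times> 'b \<Rightarrow> real"
  assumes "prob_space M" and "prob_space U" and F: "subalgebra M F"
    and V[measurable]: "V \<in> measurable M U"
    and phi[measurable]: "phi \<in> borel_measurable M" and psi[measurable]: "psi \<in> borel_measurable M"
    and phi01: "\<And>x. x \<in> space M \<Longrightarrow> 0 \<le> phi x \<and> phi x \<le> 1"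
    and psi01: "\<And>x. x \<in> space M \<Longrightarrow> 0 \<le> psi x \<and> psi x \<le> 1"
    and rect: "\<And>A B. A \<in> sets F \<Longrightarrow> B \<in> sets U \<Longrightarrow>
      (\<integral>x. phi x * (indicator A x * indicator B (V x)) \<partial>M) = (\<integral>x. psi x * indicator A x \<partial>M) * measure U B"
    and G[measurable]: "G \<in> borel_measurable (F \<Otimes>\<^sub>M U)" and GC: "\<And>z. \<bar>G z\<bar> \<le> C"
  shows "(\<integral>x. phi x * G (x, V x) \<partial>M) = (\<integral>x. psi x * (\<integral>u. G (x, u) \<partial>U) \<partial>M)"
proof -
  interpret M: prob_space M by fact
  interpret U: prob_space U by fact
  have id[measurable]: "(\<lambda>x. x) \<in> measurable M F"
    using measurable_from_subalg[OF F, of "\<lambda>x. x" F] by simp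
  have V'[measurable]: "(\<lambda>x. (x, V x)) \<in> measurable M (F \<Otimes>\<^sub>M U)"
    by measurable
  define D1 where "D1 = distr (density M (\<lambda>x. ennreal (phi x))) (F \<Otimes>\<^sub>M U) (\<lambda>x. (x, V x))"
  \<comment> \<open>The weight \<open>psi\<close> is measurable in \<open>M\<close>; the identity
    map from \<open>M\<close> to \<open>F\<close> restricts the weighted measure to the past, which
    gives the first factor of the product.\<close>
  define D2 where "D2 = distr (density M (\<lambda>x. ennreal (psi x))) F (\<lambda>x. x)"
  have setF: "A \<in> sets M" if "A \<in> sets F" for A
    using F that by (auto simp: subalgebra_def)
  have int1: "integrable M (\<lambda>x. phi x * (indicator A x * indicator B (V x)))"
    if "A \<in> sets F" "B \<in> sets U" for A B
    using that setF[OF that(1)] phi01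
    by (intro M.integrable_const_bound[where B=1] AE_I2) (auto simp: indicator_def)
  have int2: "integrable M (\<lambda>x. psi x * indicator A x)" if "A \<in> sets F" for A
    using that setF[OF that(1)] psi01
    by (intro M.integrable_const_bound[where B=1] AE_I2) (auto simp: indicator_def)
  have e1: "emeasure D1 (A \<times> B) = ennreal (\<integral>x. phi x * (indicator A x * indicator B (V x)) \<partial>M)"
    if [measurable]: "A \<in> sets F" "B \<in> sets U" for A B
  proof -
    have [measurable]: "A \<in> sets M" by (rule setF) fact
    have "emeasure D1 (A \<times> B) = emeasure (density M (\<lambda>x. ennreal (phi x))) ({x\<in>space M. x \<in> A \<and> V x \<in> B})"
      unfolding D1_def by (subst emeasure_distr) (auto intro!: arg_cong2[where f=emeasure])
    also have "\<dots> = (\<integral>\<^sup>+x. ennreal (phi x) * indicator {x\<in>space M. x \<in> A \<and> V x \<in> B} x \<partial>M)"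
      by (subst emeasure_density) auto
    also have "\<dots> = (\<integral>\<^sup>+x. ennreal (phi x * (indicator A x * indicator B (V x))) \<partial>M)"
      by (intro nn_integral_cong) (auto simp: indicator_def)
    also have "\<dots> = ennreal (\<integral>x. phi x * (indicator A x * indicator B (V x)) \<partial>M)"
      by (intro nn_integral_eq_integral int1 that AE_I2) (use phi01 in auto)
    finally show ?thesis .
  qed
  have e2: "emeasure D2 A = ennreal (\<integral>x. psi x * indicator A x \<partial>M)"
    if [measurable]: "A \<in> sets F" for A
  proof -
    have [measurable]: "A \<in> sets M" by (rule setF) fact
    have "emeasure D2 A = emeasure (density M (\<lambda>x. ennreal (psi x))) (A \<inter> space M)"
      unfolding D2_def by (subst emeasure_distr) auto
    also have "\<dots> = (\<integral>\<^sup>+x. ennreal (psi x) * indicator (A \<inter> space M) x \<partial>M)"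
      by (subst emeasure_density) auto
    also have "\<dots> = (\<integral>\<^sup>+x. ennreal (psi x * indicator A x) \<partial>M)"
      by (intro nn_integral_cong) (auto simp: indicator_def)
    also have "\<dots> = ennreal (\<integral>x. psi x * indicator A x \<partial>M)"
      by (intro nn_integral_eq_integral int2 that AE_I2) (use psi01 in auto)
    finally show ?thesis .
  qed
  have sp: "space D2 = space F" "sets D2 = sets F" unfolding D2_def by auto
  interpret D2: finite_measure D2
    by (rule finite_measureI) (simp only: sp e2[OF sets.top], simp)
  interpret D2U: pair_sigma_finite D2 U ..
  have eq: "D2 \<Otimes>\<^sub>M U = D1"
  proof (rule pair_measure_eqI)
    show "sigma_finite_measure D2" "sigma_finite_measure U" by unfold_locales
    show "sets (D2 \<Otimes>\<^sub>M U) = sets D1"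
      unfolding D1_def by (simp add: sets_pair_measure_cong[OF sp(2) refl])
    fix A B assume "A \<in> sets D2" and B: "B \<in> sets U"
    then have A: "A \<in> sets F" by (simp add: sp)
    have "0 \<le> (\<integral>x. psi x * indicator A x \<partial>M)"
      by (intro integral_nonneg_AE AE_I2) (use psi01 in auto)
    then show "emeasure D2 A * emeasure U B = emeasure D1 (A \<times> B)"
      by (simp add: e1[OF A B] e2[OF A] rect[OF A B] U.emeasure_eq_measure ennreal_mult)
  qed
  have G': "G \<in> borel_measurable (D2 \<Otimes>\<^sub>M U)"
    using G by (simp add: measurable_cong_sets[OF sets_pair_measure_cong[OF sp(2) refl] refl])
  have "integrable (D2 \<Otimes>\<^sub>M U) G"
  proof -
    interpret D: finite_measure "D2 \<Otimes>\<^sub>M U"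
      by (rule finite_measureI)
        (simp add: space_pair_measure U.emeasure_pair_measure_Times U.emeasure_eq_measure
            D2.emeasure_eq_measure ennreal_mult[symmetric])
    show ?thesis by (rule D.integrable_const_bound[where B=C, OF _ G']) (auto simp: GC)
  qed
  then have fub: "(\<integral>x. (\<integral>u. G (x, u) \<partial>U) \<partial>D2) = integral\<^sup>L (D2 \<Otimes>\<^sub>M U) G"
    by (rule D2U.integral_fst')
  have g2: "(\<lambda>x. \<integral>u. G (x, u) \<partial>U) \<in> borel_measurable F"
    by measurable
  have g2'[measurable]: "(\<lambda>x. \<integral>u. G (x, u) \<partial>U) \<in> borel_measurable M"
    using measurable_from_subalg[OF F g2] .
  have [measurable]: "(\<lambda>x. G (x, V x)) \<in> borel_measurable M"
    by measurable
  have "(\<integral>x. phi x * G (x, V x) \<partial>M) = (\<integral>x. G (x, V x) \<partial>density M (\<lambda>x. ennreal (phi x)))"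
    by (subst integral_density) (use phi01 in auto)
  also have "\<dots> = integral\<^sup>L D1 G"
    unfolding D1_def by (subst integral_distr) auto
  also have "\<dots> = (\<integral>x. (\<integral>u. G (x, u) \<partial>U) \<partial>D2)"
    by (simp add: fub eq)
  also have "\<dots> = (\<integral>x. (\<integral>u. G (x, u) \<partial>U) \<partial>density M (\<lambda>x. ennreal (psi x)))"
    unfolding D2_def by (subst integral_distr) auto
  also have "\<dots> = (\<integral>x. psi x * (\<integral>u. G (x, u) \<partial>U) \<partial>M)"
    by (subst integral_density) (use psi01 in auto)
  finally show ?thesis .
qed

text \<open>The squared mean absolute deviation is at most the variance, because the absolute
  deviation itself has nonnegative variance. Adding the squared mean gives the second
  moment.\<close>

lemma (in prob_space) second_moment_split:
  fixes f :: "'a \<Rightarrow> real"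
  assumes f[measurable]: "f \<in> borel_measurable M" and C: "\<And>x. \<bar>f x\<bar> \<le> C"
  shows "(expectation f)\<^sup>2 + (expectation (\<lambda>x. \<bar>f x - expectation f\<bar>))\<^sup>2 \<le> expectation (\<lambda>x. (f x)\<^sup>2)"
proof -
  have C0: "0 \<le> C" using C[of undefined] by linarith
  have C2: "(f x)\<^sup>2 \<le> C\<^sup>2" for x
    using C[of x] by (metis abs_le_square_iff abs_of_nonneg C0)
  have i: "integrable M f" by (rule integrable_const_bound[where B=C]) (auto simp: C)
  have i2: "integrable M (\<lambda>x. (f x)\<^sup>2)" by (rule integrable_const_bound[where B="C\<^sup>2"]) (auto simp: C2)
  let ?g = "\<lambda>x. \<bar>f x - expectation f\<bar>"
  have ig: "integrable M ?g" using i by auto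
  have ig2: "integrable M (\<lambda>x. (?g x)\<^sup>2)"
    using i i2 by (simp add: power2_diff)
  have "0 \<le> variance ?g" by (rule variance_positive)
  then have "(expectation ?g)\<^sup>2 \<le> expectation (\<lambda>x. (?g x)\<^sup>2)"
    by (subst (asm) variance_eq[OF ig ig2]) simp
  also have "\<dots> = expectation (\<lambda>x. (f x)\<^sup>2) - (expectation f)\<^sup>2"
    using variance_eq[OF i i2] by simp
  finally show ?thesis by simp
qed

text \<open>With \<open>m\<close> the mean and \<open>d\<close> the mean absolute deviation of
  \<open>H\<close> over the fresh variable, the left side is at most the expectation of
  \<open>m + e * CARD('w) * d\<close>. The vector \<open>(m, d)\<close> has norm at most the L2 norm
  of \<open>H\<close> in the fresh variable by \<open>second_moment_split\<close>, so the square
  root factor is the norm of \<open>(1, e * CARD('w))\<close>.\<close>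

lemma marked_or_fresh_step_le:
  fixes V :: "'w::finite \<Rightarrow> 'a \<Rightarrow> 'b" and H :: "'a \<times> 'b \<Rightarrow> real"
  assumes "prob_space M" and "prob_space U" and F: "subalgebra M F"
    and V[measurable]: "\<And>v. V v \<in> measurable M U"
    and w[measurable]: "w \<in> measurable M (count_space UNIV)"
    and Z[measurable]: "Measurable.pred M Z"
    and P[measurable]: "\<And>v. (\<lambda>x. P x v) \<in> borel_measurable M"
    and P01: "\<And>x v. x \<in> space M \<Longrightarrow> 0 \<le> P x v \<and> P x v \<le> 1"
    and e: "0 \<le> e" "e \<le> 1"
    and marked: "\<And>A B v. A \<in> sets F \<Longrightarrow> B \<in> sets U \<Longrightarrow>
      (\<integral>x. of_bool (Z x) * (indicator A x * indicator B (V v x)) \<partial>M) = e * measure M A * measure U B"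
    and unmarked: "\<And>A B v. A \<in> sets F \<Longrightarrow> B \<in> sets U \<Longrightarrow>
      (\<integral>x. of_bool (\<not> Z x \<and> w x = v) * (indicator A x * indicator B (V v x)) \<partial>M)
        = (\<integral>x. (1 - e) * P x v * indicator A x \<partial>M) * measure U B"
    and H[measurable]: "H \<in> borel_measurable (F \<Otimes>\<^sub>M U)" and HC: "\<And>z. \<bar>H z\<bar> \<le> C"
  shows "(\<integral>x. H (x, V (w x) x) \<partial>M)
    \<le> sqrt (1 + (e * real CARD('w))\<^sup>2) * (\<integral>x. sqrt (\<integral>u. (H (x, u))\<^sup>2 \<partial>U) \<partial>M)"
proof -
  interpret M: prob_space M by fact
  interpret U: prob_space U by fact
  have C0: "0 \<le> C" using HC[of undefined] by linarith
  have id[measurable]: "(\<lambda>x. x) \<in> measurable M F"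
    using measurable_from_subalg[OF F, of "\<lambda>x. x" F] by simp
  define m where "m x = (\<integral>u. H (x, u) \<partial>U)" for x
  define k where "k z = H z - m (fst z)" for z
  define d where "d x = (\<integral>u. \<bar>k (x, u)\<bar> \<partial>U)" for x
  have mF[measurable]: "m \<in> borel_measurable F" unfolding m_def by measurable
  have k[measurable]: "k \<in> borel_measurable (F \<Otimes>\<^sub>M U)" unfolding k_def by measurable
  have dF[measurable]: "d \<in> borel_measurable F" unfolding d_def by measurable
  have mM[measurable]: "m \<in> borel_measurable M" by (rule measurable_from_subalg[OF F mF])
  have dM[measurable]: "d \<in> borel_measurable M" by (rule measurable_from_subalg[OF F dF])
  \<comment> \<open>Measurability of \<open>f\<close> is not asked for, since a non-integrable
    function has integral 0. Hence the bounds on \<open>m\<close>, \<open>k\<close> and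
    \<open>d\<close> hold at every point, also outside \<open>space M\<close>, as the global bound
    in \<open>integral_weighted_pair\<close> demands.\<close>
  have bound: "\<bar>\<integral>u. f u \<partial>U\<bar> \<le> D" if "\<And>u. \<bar>f u\<bar> \<le> D" for f :: "'b \<Rightarrow> real" and D
  proof -
    have D0: "0 \<le> D" using that[of undefined] by linarith
    have "\<bar>\<integral>u. f u \<partial>U\<bar> \<le> (\<integral>u. \<bar>f u\<bar> \<partial>U)" by (rule integral_abs_bound)
    also have "\<dots> \<le> (\<integral>u. D \<partial>U)" using that D0 by (intro integral_mono') auto
    finally show ?thesis by (simp add: U.prob_space)
  qed
  have mC: "\<bar>m x\<bar> \<le> C" for x unfolding m_def by (rule bound) (rule HC)
  have kC: "\<bar>k z\<bar> \<le> 2 * C" for z unfolding k_def using HC[of z] mC[of "fst z"] by linarith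
  have dC: "\<bar>d x\<bar> \<le> 2 * C" for x unfolding d_def by (rule bound) (simp add: kC)
  have [measurable]: "(\<lambda>u. H (x, u)) \<in> borel_measurable U" if "x \<in> space M" for x
    using that F by (auto simp: subalgebra_def intro!: measurable_compose[OF measurable_Pair1' H])
  have ik: "(\<integral>u. k (x, u) \<partial>U) = 0" if "x \<in> space M" for x
  proof -
    have "integrable U (\<lambda>u. H (x, u))"
      by (rule U.integrable_const_bound[where B=C]) (auto simp: HC that)
    then show ?thesis by (simp add: k_def m_def U.prob_space)
  qed
  have kV[measurable]: "(\<lambda>x. k (x, V v x)) \<in> borel_measurable M" for v by measurable
  have kw[measurable]: "(\<lambda>x. k (x, V (w x) x)) \<in> borel_measurable M"
    by (rule measurable_compose_countable'[where I=UNIV]) (auto intro: countable_finite)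
  have int: "integrable M f" if "f \<in> borel_measurable M" "\<And>x. \<bar>f x\<bar> \<le> D" for f :: "'a \<Rightarrow> real" and D
    by (rule M.integrable_const_bound[where B=D]) (use that in auto)
  have intm: "integrable M m" by (rule int[OF _ mC]) simp
  have intd: "integrable M d" by (rule int[OF _ dC]) simp
  have intZ: "integrable M (\<lambda>x. of_bool (Z x) * \<bar>k (x, V v x)\<bar>)" for v
    by (rule int[of _ "2 * C"]) (use kC C0 in auto)
  have intZw: "integrable M (\<lambda>x. of_bool (Z x) * k (x, V (w x) x))"
    by (rule int[of _ "2 * C"]) (use kC C0 in auto)
  have intN: "integrable M (\<lambda>x. of_bool (\<not> Z x \<and> w x = v) * k (x, V v x))" for v
    by (rule int[of _ "2 * C"]) (use kC C0 in auto)
  \<comment> \<open>Fixing the value \<open>v\<close> of an unmarked token makes the pivot a fixed coordinate of \<open>\<xi>\<close>.\<close>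
  have split: "H (x, V (w x) x) = m x + of_bool (Z x) * k (x, V (w x) x)
      + (\<Sum>v\<in>UNIV. of_bool (\<not> Z x \<and> w x = v) * k (x, V v x))" for x
  proof -
    have "(\<Sum>v\<in>UNIV. of_bool (\<not> Z x \<and> w x = v) * k (x, V v x))
        = (\<Sum>v\<in>UNIV. if v = w x then of_bool (\<not> Z x) * k (x, V v x) else 0)"
      by (intro sum.cong) auto
    also have "\<dots> = of_bool (\<not> Z x) * k (x, V (w x) x)"
      by (subst sum.delta) auto
    finally show ?thesis by (auto simp: k_def)
  qed
  \<comment> \<open>Seen from the past, the event that the token is unmarked and equal to
    \<open>v\<close> has weight \<open>(1 - e) * P x v\<close>, and \<open>k\<close> integrates to 0
    over the fresh variable.\<close>
  have N0: "(\<integral>x. of_bool (\<not> Z x \<and> w x = v) * k (x, V v x) \<partial>M) = 0" for v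
  proof -
    have "(\<integral>x. of_bool (\<not> Z x \<and> w x = v) * k (x, V v x) \<partial>M)
        = (\<integral>x. (1 - e) * P x v * (\<integral>u. k (x, u) \<partial>U) \<partial>M)"
      by (rule integral_weighted_pair[OF \<open>prob_space M\<close> \<open>prob_space U\<close> F, where C="2 * C"])
        (use P01 e unmarked kC in \<open>auto intro: mult_le_one\<close>)
    also have "\<dots> = (\<integral>x. 0 \<partial>M)"
      by (intro Bochner_Integration.integral_cong) (auto simp: ik)
    finally show ?thesis by simp
  qed
  have Zv: "(\<integral>x. of_bool (Z x) * \<bar>k (x, V v x)\<bar> \<partial>M) = e * (\<integral>x. d x \<partial>M)" for v
  proof -
    have "(\<integral>x. of_bool (Z x) * \<bar>k (x, V v x)\<bar> \<partial>M) = (\<integral>x. e * (\<integral>u. \<bar>k (x, u)\<bar> \<partial>U) \<partial>M)"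
    proof (rule integral_weighted_pair[OF \<open>prob_space M\<close> \<open>prob_space U\<close> F, where C="2 * C"])
      fix A B assume A: "A \<in> sets F" and B: "B \<in> sets U"
      have "A \<in> sets M" using A F by (auto simp: subalgebra_def)
      then show "(\<integral>x. of_bool (Z x) * (indicator A x * indicator B (V v x)) \<partial>M)
          = (\<integral>x. e * indicator A x \<partial>M) * measure U B"
        using marked[OF A B, of v] sets.sets_into_space[of A M] by (simp add: Int_absorb2)
    qed (use e kC in auto)
    then show ?thesis unfolding d_def by simp
  qed
  \<comment> \<open>A marked token may depend on the fresh coordinates, so its pivot cannot be
    treated as a fixed coordinate. The sum of absolute values over all coordinates dominates
    whichever one is chosen, at the price of the factor \<open>CARD('w)\<close>.\<close>
  have "(\<integral>x. of_bool (Z x) * k (x, V (w x) x) \<partial>M)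
      \<le> (\<integral>x. (\<Sum>v\<in>UNIV. of_bool (Z x) * \<bar>k (x, V v x)\<bar>) \<partial>M)"
  proof (intro integral_mono intZw Bochner_Integration.integrable_sum intZ)
    fix x
    have "of_bool (Z x) * k (x, V (w x) x) \<le> of_bool (Z x) * \<bar>k (x, V (w x) x)\<bar>" by auto
    also have "\<dots> \<le> (\<Sum>v\<in>UNIV. of_bool (Z x) * \<bar>k (x, V v x)\<bar>)"
      by (rule member_le_sum) auto
    finally show "of_bool (Z x) * k (x, V (w x) x) \<le> (\<Sum>v\<in>UNIV. of_bool (Z x) * \<bar>k (x, V v x)\<bar>)" .
  qed
  also have "\<dots> = real CARD('w) * (e * (\<integral>x. d x \<partial>M))"
    by (subst Bochner_Integration.integral_sum) (auto simp: intZ Zv)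
  finally have Zb: "(\<integral>x. of_bool (Z x) * k (x, V (w x) x) \<partial>M) \<le> real CARD('w) * (e * (\<integral>x. d x \<partial>M))" .
  have "(\<integral>x. H (x, V (w x) x) \<partial>M) = (\<integral>x. m x \<partial>M) + (\<integral>x. of_bool (Z x) * k (x, V (w x) x) \<partial>M)
      + (\<Sum>v\<in>UNIV. \<integral>x. of_bool (\<not> Z x \<and> w x = v) * k (x, V v x) \<partial>M)"
    unfolding split
    by (simp only: Bochner_Integration.integral_add Bochner_Integration.integrable_add
        Bochner_Integration.integral_sum Bochner_Integration.integrable_sum intm intZw intN)
  also have "\<dots> \<le> (\<integral>x. m x \<partial>M) + real CARD('w) * (e * (\<integral>x. d x \<partial>M))"
    using Zb N0 by simp
  also have "\<dots> = (\<integral>x. m x + e * real CARD('w) * d x \<partial>M)"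
    using intm intd by simp
  also have "\<dots> \<le> (\<integral>x. sqrt (1 + (e * real CARD('w))\<^sup>2) * sqrt (\<integral>u. (H (x, u))\<^sup>2 \<partial>U) \<partial>M)"
  proof (rule integral_mono)
    show "integrable M (\<lambda>x. m x + e * real CARD('w) * d x)" using intm intd by simp
    have sq: "\<bar>(H z)\<^sup>2\<bar> \<le> C\<^sup>2" for z
      using HC[of z] by (metis abs_le_square_iff abs_of_nonneg C0 abs_power2)
    have "\<bar>sqrt (\<integral>u. (H (x, u))\<^sup>2 \<partial>U)\<bar> \<le> C" for x
    proof -
      have "\<bar>\<integral>u. (H (x, u))\<^sup>2 \<partial>U\<bar> \<le> C\<^sup>2" by (rule bound) (rule sq)
      then show ?thesis using C0 by (intro abs_leI real_le_lsqrt) (auto intro: order_trans[of _ 0])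
    qed
    moreover have "(\<lambda>x. sqrt (\<integral>u. (H (x, u))\<^sup>2 \<partial>U)) \<in> borel_measurable M"
      by (rule measurable_from_subalg[OF F]) measurable
    ultimately show "integrable M (\<lambda>x. sqrt (1 + (e * real CARD('w))\<^sup>2) * sqrt (\<integral>u. (H (x, u))\<^sup>2 \<partial>U))"
      by (intro integrable_mult_right int)
    fix x assume x: "x \<in> space M"
    let ?c = "e * real CARD('w)"
    \<comment> \<open>Cauchy-Schwarz for the plane vectors \<open>(1, ?c)\<close> and
      \<open>(m x, d x)\<close>; the deficit is the square of their determinant.\<close>
    have "m x + ?c * d x \<le> sqrt ((1 + ?c\<^sup>2) * ((m x)\<^sup>2 + (d x)\<^sup>2))"
    proof (rule real_le_rsqrt)
      have "(1 + ?c\<^sup>2) * ((m x)\<^sup>2 + (d x)\<^sup>2) - (m x + ?c * d x)\<^sup>2 = (?c * m x - d x)\<^sup>2"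
        by (simp add: power2_eq_square algebra_simps)
      then show "(m x + ?c * d x)\<^sup>2 \<le> (1 + ?c\<^sup>2) * ((m x)\<^sup>2 + (d x)\<^sup>2)"
        using zero_le_power2[of "?c * m x - d x"] by linarith
    qed
    also have "\<dots> \<le> sqrt ((1 + ?c\<^sup>2) * (\<integral>u. (H (x, u))\<^sup>2 \<partial>U))"
      using U.second_moment_split[of "\<lambda>u. H (x, u)" C] x HC
      by (intro real_sqrt_le_mono mult_left_mono) (auto simp: m_def d_def k_def)
    finally show "m x + ?c * d x \<le> sqrt (1 + ?c\<^sup>2) * sqrt (\<integral>u. (H (x, u))\<^sup>2 \<partial>U)"
      by (simp add: real_sqrt_mult)
  qed
  finally show ?thesis by simp
qed

section \<open>The watermark model: history, single coordinates and the one-step bound\<close>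

abbreviation unif :: "real measure" where
  "unif \<equiv> uniform_measure lborel {0..1}"

lemma prob_space_unif: "prob_space unif"
  by (rule prob_space_uniform_measure) auto

lemma gen_sets_subset_sets: "X \<in> measurable M N \<Longrightarrow> gen_sets M X N \<subseteq> sets M"
  by (auto simp: gen_sets_def)

lemma measurable_gen_sets:
  assumes "X \<in> measurable M N" "gen_sets M X N \<subseteq> sets F" "space F = space M"
  shows "X \<in> measurable F N"
  using assms by (auto simp: measurable_def gen_sets_def)

text \<open>\<open>hist_sets\<close> packaged as a measure, so that the history before token
  \<open>t\<close> can act as a sub-sigma-algebra of \<open>M\<close>. It already contains
  \<open>P t\<close>, but \<open>xi\<close> and \<open>w\<close> only up to
  \<open>t - 1\<close>.\<close>

definition hist :: "'a measure \<Rightarrow> (nat \<Rightarrow> 'a \<Rightarrow> 'w::finite \<Rightarrow> real) \<Rightarrow> (nat \<Rightarrow> 'a \<Rightarrow> 'w \<Rightarrow> real)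
   \<Rightarrow> (nat \<Rightarrow> 'a \<Rightarrow> 'w) \<Rightarrow> nat \<Rightarrow> 'a measure" where
  "hist M P xi w t = sigma (space M)
     ((\<Union>j\<in>{1..t}. gen_sets M (P j) vecM)
      \<union> (\<Union>j\<in>{1..<t}. gen_sets M (xi j) vecM)
      \<union> (\<Union>j\<in>{1..<t}. gen_sets M (w j) (count_space UNIV)))"

lemma space_hist: "space (hist M P xi w t) = space M"
  by (simp add: hist_def space_measure_of_conv)

lemma sets_hist: "sets (hist M P xi w t) = hist_sets M P xi w t"
  unfolding hist_def hist_sets_def by (rule sets_measure_of) (auto simp: gen_sets_def)

context
  fixes M :: "'a measure" and n :: nat and e :: real
    and P :: "nat \<Rightarrow> 'a \<Rightarrow> 'w::finite \<Rightarrow> real" and xi w Z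
  assumes model: "watermark_model M n e P xi w Z"
begin

lemma model_prob_space: "prob_space M"
  using model by (simp add: watermark_model_def)

lemma model_measurable:
  assumes "t \<in> {1..n}"
  shows "P t \<in> measurable M vecM" "xi t \<in> measurable M vecM" "w t \<in> measurable M (count_space UNIV)"
    "Measurable.pred M (Z t)"
  using model assms by (auto simp: watermark_model_def pred_def)

lemma subalgebra_hist:
  assumes "t \<in> {1..n}"
  shows "subalgebra M (hist M P xi w t)"
proof -
  have "hist_sets M P xi w t \<subseteq> sets M"
    unfolding hist_sets_def
  proof (rule sets.sigma_sets_subset, intro Un_least UN_least)
    show "gen_sets M (P j) vecM \<subseteq> sets M" if "j \<in> {1..t}" for j
      by (rule gen_sets_subset_sets, rule model_measurable) (use that assms in auto)
    show "gen_sets M (xi j) vecM \<subseteq> sets M" if "j \<in> {1..<t}" for j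
      by (rule gen_sets_subset_sets, rule model_measurable) (use that assms in auto)
    show "gen_sets M (w j) (count_space UNIV) \<subseteq> sets M" if "j \<in> {1..<t}" for j
      by (rule gen_sets_subset_sets, rule model_measurable) (use that assms in auto)
  qed
  then show ?thesis by (simp add: subalgebra_def space_hist sets_hist)
qed

lemma hist_measurable:
  assumes "t \<in> {1..n}"
  shows "j \<in> {1..t} \<Longrightarrow> P j \<in> measurable (hist M P xi w t) vecM"
    and "j \<in> {1..<t} \<Longrightarrow> xi j \<in> measurable (hist M P xi w t) vecM"
    and "j \<in> {1..<t} \<Longrightarrow> w j \<in> measurable (hist M P xi w t) (count_space UNIV)"
proof -
  have G: "X \<in> hist_sets M P xi w t"
    if "X \<in> (\<Union>j\<in>{1..t}. gen_sets M (P j) vecM) \<union> (\<Union>j\<in>{1..<t}. gen_sets M (xi j) vecM)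
      \<union> (\<Union>j\<in>{1..<t}. gen_sets M (w j) (count_space UNIV))" for X
    unfolding hist_sets_def using that by (rule sigma_sets.Basic)
  show "j \<in> {1..t} \<Longrightarrow> P j \<in> measurable (hist M P xi w t) vecM"
    by (rule measurable_gen_sets[OF model_measurable(1) _ space_hist])
      (use assms in \<open>auto simp: sets_hist intro!: G\<close>)
  show "j \<in> {1..<t} \<Longrightarrow> xi j \<in> measurable (hist M P xi w t) vecM"
    by (rule measurable_gen_sets[OF model_measurable(2) _ space_hist])
      (use assms in \<open>auto simp: sets_hist intro!: G\<close>)
  show "j \<in> {1..<t} \<Longrightarrow> w j \<in> measurable (hist M P xi w t) (count_space UNIV)"
    by (rule measurable_gen_sets[OF model_measurable(3) _ space_hist])
      (use assms in \<open>auto simp: sets_hist intro!: G\<close>)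
qed

text \<open>The token takes finitely many values, so evaluation at a random index glues finitely
  many measurable coordinates. \<open>F\<close> is left free to serve both for \<open>M\<close> and
  for the history.\<close>

lemma pivot_measurable:
  assumes "w j \<in> measurable F (count_space UNIV)" "xi j \<in> measurable F vecM"
  shows "(\<lambda>x. xi j x (w j x)) \<in> borel_measurable F"
proof (rule measurable_compose_countable'[OF _ assms(1)])
  show "(\<lambda>x. xi j x v) \<in> borel_measurable F" for v
    using measurable_compose[OF assms(2) measurable_component_singleton[of v UNIV "\<lambda>_. borel"]] by simp
qed (auto intro: countable_finite)

text \<open>The model speaks of events of the whole vector \<open>xi t\<close>. Here it is applied
  to cylinders over one coordinate \<open>v\<close>, whose marginal under the product law is
  \<open>unif\<close>. In the third formula the coordinate still sits under the integral;
  \<open>model_step_le\<close> separates it.\<close>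

lemma model_measure_xi:
  assumes t: "t \<in> {1..n}" and A: "A \<in> sets (hist M P xi w t)" and B: "B \<in> sets borel"
  shows "measure M {x\<in>space M. x \<in> A \<and> xi t x v \<in> B} = measure M A * measure unif B"
    and "measure M {x\<in>space M. x \<in> A \<and> xi t x v \<in> B \<and> Z t x} = e * measure M A * measure unif B"
    and "measure M {x\<in>space M. x \<in> A \<and> xi t x v \<in> B \<and> \<not> Z t x \<and> w t x = v}
      = (\<integral>x. of_bool (\<not> Z t x) * (P t x v * (indicator A x * indicator B (xi t x v))) \<partial>M)"
proof -
  note [measurable] = model_measurable[OF t]
  let ?B = "{u. u v \<in> B}"
  have B'[measurable]: "?B \<in> sets vecM"
  proof -
    have "(\<lambda>u. u v) -` B \<inter> space (vecM :: ('w \<Rightarrow> real) measure) \<in> sets vecM"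
      by (rule measurable_sets[OF _ B]) (rule measurable_component_singleton, simp)
    then show ?thesis by (simp add: space_PiM vimage_def)
  qed
  have A': "A \<in> hist_sets M P xi w t" and AM: "A \<in> sets M"
    using A subalgebra_hist[OF t] by (auto simp: sets_hist subalgebra_def)
  note Asp = sets.sets_into_space[OF AM]
  have dis: "distr M vecM (xi t) = PiM UNIV (\<lambda>_. unif)"
    using model t by (auto simp: watermark_model_def)
  have "measure M (xi t -` ?B \<inter> space M) = measure (distr M vecM (xi t)) ?B"
    by (subst measure_distr) auto
  also have "\<dots> = measure (PiM UNIV (\<lambda>_. unif)) ((\<lambda>u. u v) -` B \<inter> space (PiM UNIV (\<lambda>_. unif)))"
    unfolding dis by (rule arg_cong[where f="measure _"]) (auto simp: space_PiM)
  also have "\<dots> = measure (distr (PiM UNIV (\<lambda>_::'w. unif)) unif (\<lambda>u. u v)) B"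
    by (subst measure_distr) (use B in auto)
  also have "\<dots> = measure unif B"
    by (subst distr_PiM_component) (auto intro: prob_space_unif)
  finally have xiB: "measure M (xi t -` ?B \<inter> space M) = measure unif B" .
  have e1: "A \<inter> xi t -` ?B = {x\<in>space M. x \<in> A \<and> xi t x v \<in> B}"
    "A \<inter> xi t -` ?B \<inter> {x. Z t x} = {x\<in>space M. x \<in> A \<and> xi t x v \<in> B \<and> Z t x}"
    "A \<inter> xi t -` ?B \<inter> {x. \<not> Z t x} \<inter> {x. w t x = v}
      = {x\<in>space M. x \<in> A \<and> xi t x v \<in> B \<and> \<not> Z t x \<and> w t x = v}"
    using Asp by auto
  have "measure M (A \<inter> xi t -` ?B) = measure M A * measure M (xi t -` ?B \<inter> space M)"
    using model t A' B' unfolding watermark_model_def by blast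
  then show 1: "measure M {x\<in>space M. x \<in> A \<and> xi t x v \<in> B} = measure M A * measure unif B"
    by (simp only: xiB e1)
  have 2: "measure M (A \<inter> xi t -` ?B \<inter> {x. Z t x}) = e * measure M (A \<inter> xi t -` ?B)"
    using model t A' B' unfolding watermark_model_def by blast
  show "measure M {x\<in>space M. x \<in> A \<and> xi t x v \<in> B \<and> Z t x} = e * measure M A * measure unif B"
    using 2[unfolded e1(2), unfolded e1(1) 1] by (simp only: mult.assoc)
  have "measure M {x\<in>space M. x \<in> A \<and> xi t x v \<in> B \<and> \<not> Z t x \<and> w t x = v}
      = measure M (A \<inter> xi t -` ?B \<inter> {x. \<not> Z t x} \<inter> {x. w t x = v})"
    by (simp only: e1(3))
  also have "\<dots> = (\<integral>x. indicator (A \<inter> xi t -` ?B \<inter> {x. \<not> Z t x}) x * P t x v \<partial>M)"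
    using model t A' B' unfolding watermark_model_def by blast
  also have "\<dots> = (\<integral>x. of_bool (\<not> Z t x) * (P t x v * (indicator A x * indicator B (xi t x v))) \<partial>M)"
    by (intro Bochner_Integration.integral_cong) (auto simp: indicator_def)
  finally show "measure M {x\<in>space M. x \<in> A \<and> xi t x v \<in> B \<and> \<not> Z t x \<and> w t x = v}
      = (\<integral>x. of_bool (\<not> Z t x) * (P t x v * (indicator A x * indicator B (xi t x v))) \<partial>M)" .
qed

text \<open>\<open>e\<close> is the probability of \<open>Z t\<close>: take \<open>space M\<close>
  for the past event and \<open>UNIV\<close> for the coordinate event. The bounds make
  \<open>e\<close> and \<open>1 - e\<close> admissible weights.\<close>

lemma eps_bounds:
  assumes t: "t \<in> {1..n}"
  shows "0 \<le> e" "e \<le> 1"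
proof -
  interpret M: prob_space M by (rule model_prob_space)
  have "measure M {x\<in>space M. x \<in> space M \<and> xi t x undefined \<in> UNIV \<and> Z t x} = e"
    using model_measure_xi(2)[OF t, of "space M" UNIV undefined]
      sets.top[of "hist M P xi w t"] prob_space.prob_space[OF prob_space_unif]
    by (simp add: space_hist M.prob_space)
  then show "0 \<le> e" "e \<le> 1" using measure_nonneg M.prob_le_1 by metis+
qed

text \<open>The history plays the past and the coordinates of \<open>xi t\<close> play the fresh
  variables of \<open>marked_or_fresh_step_le\<close>; the work lies in deriving its
  \<open>unmarked\<close> hypothesis.\<close>

lemma model_step_le:
  fixes H :: "'a \<times> real \<Rightarrow> real"
  assumes t: "t \<in> {1..n}"
    and H[measurable]: "H \<in> borel_measurable (hist M P xi w t \<Otimes>\<^sub>M borel)" and HC: "\<And>z. \<bar>H z\<bar> \<le> C"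
  shows "(\<integral>x. H (x, xi t x (w t x)) \<partial>M)
    \<le> sqrt (1 + (e * real CARD('w))\<^sup>2) * (\<integral>x. sqrt (\<integral>u. (H (x, u))\<^sup>2 \<partial>unif) \<partial>M)"
proof -
  interpret M: prob_space M by (rule model_prob_space)
  note [measurable] = model_measurable[OF t]
  let ?F = "hist M P xi w t"
  have F: "subalgebra M ?F" by (rule subalgebra_hist[OF t])
  have xiv[measurable]: "(\<lambda>x. xi t x v) \<in> borel_measurable M" for v
    using measurable_compose[OF model_measurable(2)[OF t] measurable_component_singleton[of v UNIV "\<lambda>_. borel"]] by simp
  have Pv[measurable]: "(\<lambda>x. P t x v) \<in> borel_measurable M" for v
    using measurable_compose[OF model_measurable(1)[OF t] measurable_component_singleton[of v UNIV "\<lambda>_. borel"]] by simp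
  have PF[measurable]: "(\<lambda>x. P t x v) \<in> borel_measurable ?F" for v
    using measurable_compose[OF hist_measurable(1)[OF t, of t] measurable_component_singleton[of v UNIV "\<lambda>_. borel"]] t by simp
  have prob: "prob_vector (P t x)" if "x \<in> space M" for x
    using model t that by (auto simp: watermark_model_def)
  have P01: "0 \<le> P t x v \<and> P t x v \<le> 1" if "x \<in> space M" for x v
    using prob[OF that] member_le_sum[of v UNIV "P t x"] by (auto simp: prob_vector_def)
  have clip: "max 0 (min 1 (P t x v)) = P t x v" if "x \<in> space M" for x v
    using P01[OF that, of v] by auto
  note ps = model_prob_space prob_space_unif
  have AM: "A \<in> sets M" if "A \<in> sets ?F" for A using that F by (auto simp: subalgebra_def)
  have ind: "(\<integral>x. of_bool (Q x) * (indicator A x * indicator B (xi t x v)) \<partial>M)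
      = measure M {x\<in>space M. x \<in> A \<and> xi t x v \<in> B \<and> Q x}" for Q A B v
  proof -
    have "(\<integral>x. of_bool (Q x) * (indicator A x * indicator B (xi t x v)) \<partial>M)
      = (\<integral>x. indicat_real {x\<in>space M. x \<in> A \<and> xi t x v \<in> B \<and> Q x} x \<partial>M)"
      by (intro Bochner_Integration.integral_cong) (auto simp: indicator_def)
    then show ?thesis by (simp add: Int_def conj_commute)
  qed
  have marked: "(\<integral>x. of_bool (Z t x) * (indicator A x * indicator B (xi t x v)) \<partial>M)
      = e * measure M A * measure unif B" if "A \<in> sets ?F" "B \<in> sets unif" for A B v
    using model_measure_xi(2)[OF t that(1), of B v] that(2) by (simp add: ind)
  \<comment> \<open>Independence of \<open>xi t\<close> from the past gives the total, and the
    marked part takes the share \<open>e\<close>, so the complement keeps the constant share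
    \<open>1 - e\<close>.\<close>
  have unmarkedA: "(\<integral>x. of_bool (\<not> Z t x) * (indicator A x * indicator B (xi t x v)) \<partial>M)
      = (\<integral>x. (1 - e) * indicator A x \<partial>M) * measure unif B"
    if A: "A \<in> sets ?F" and B: "B \<in> sets unif" for A B v
  proof -
    have [measurable]: "A \<in> sets M" "B \<in> sets borel" using AM A B by auto
    have "measure M {x\<in>space M. x \<in> A \<and> xi t x v \<in> B}
        = measure M {x\<in>space M. x \<in> A \<and> xi t x v \<in> B \<and> Z t x}
        + measure M {x\<in>space M. x \<in> A \<and> xi t x v \<in> B \<and> \<not> Z t x}"
      by (subst M.finite_measure_Union[symmetric]) (auto intro!: arg_cong[where f="measure M"])
    then have "measure M {x\<in>space M. x \<in> A \<and> xi t x v \<in> B \<and> \<not> Z t x} = (1 - e) * measure M A * measure unif B"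
      using model_measure_xi(1,2)[OF t A, of B v] B by (simp add: algebra_simps)
    then show ?thesis
      using sets.sets_into_space[OF AM[OF A]] by (simp add: ind Int_absorb2)
  qed
  \<comment> \<open>Since \<open>P t\<close> belongs to the history, it can be absorbed into the
    test function \<open>G\<close>; \<open>integral_weighted_pair\<close> with the constant weight
    \<open>1 - e\<close> then splits off the coordinate.\<close>
  have unmarked: "(\<integral>x. of_bool (\<not> Z t x \<and> w t x = v) * (indicator A x * indicator B (xi t x v)) \<partial>M)
        = (\<integral>x. (1 - e) * P t x v * indicator A x \<partial>M) * measure unif B"
    if A: "A \<in> sets ?F" and B: "B \<in> sets unif" for A B v
  proof -
    have [measurable]: "A \<in> sets ?F" "B \<in> sets borel" using A B by auto
    \<comment> \<open>\<open>P\<close> is a probability vector only on \<open>space M\<close>, so it is clipped to stay bounded everywhere.\<close>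
    define G where "G = (\<lambda>(x, u). max 0 (min 1 (P t x v)) * (indicator A x * indicator B u) :: real)"
    have [measurable]: "G \<in> borel_measurable (?F \<Otimes>\<^sub>M unif)" unfolding G_def by measurable
    have "(\<integral>x. of_bool (\<not> Z t x \<and> w t x = v) * (indicator A x * indicator B (xi t x v)) \<partial>M)
        = (\<integral>x. of_bool (\<not> Z t x) * (P t x v * (indicator A x * indicator B (xi t x v))) \<partial>M)"
      using model_measure_xi(3)[OF t A, of B v] B by (simp add: ind del: of_bool_conj)
    also have "\<dots> = (\<integral>x. of_bool (\<not> Z t x) * G (x, xi t x v) \<partial>M)"
      by (intro Bochner_Integration.integral_cong) (use clip in \<open>auto simp: G_def\<close>)
    also have "\<dots> = (\<integral>x. (1 - e) * (\<integral>u. G (x, u) \<partial>unif) \<partial>M)"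
      by (rule integral_weighted_pair[OF ps F, where C=1])
        (use eps_bounds[OF t] unmarkedA in \<open>auto simp: G_def indicator_def\<close>)
    also have "\<dots> = (\<integral>x. ((1 - e) * P t x v * indicator A x) * measure unif B \<partial>M)"
      by (intro Bochner_Integration.integral_cong) (use clip in \<open>auto simp: G_def\<close>)
    finally show ?thesis by simp
  qed
  show ?thesis
    by (rule marked_or_fresh_step_le[OF ps F, where V="\<lambda>v x. xi t x v" and w="w t" and Z="Z t" and P="P t" and C=C])
      (use P01 eps_bounds[OF t] marked unmarked HC in \<open>auto simp del: of_bool_conj\<close>)
qed

end

section \<open>Iterating the one-step bound over the tokens\<close>

lemma prob_space_null_law: "prob_space (null_law n)"
  unfolding null_law_def by (intro prob_space_PiM prob_space_unif)

lemma sets_null_law[measurable_cong]: "sets (null_law n) = sets (PiM {1..n} (\<lambda>_. borel))"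
  unfolding null_law_def by (intro sets_PiM_cong) auto

lemma null_law_Suc:
  fixes f :: "(nat \<Rightarrow> real) \<Rightarrow> real"
  assumes f[measurable]: "f \<in> borel_measurable (PiM {1..Suc t} (\<lambda>_. borel))" and C: "\<And>y. \<bar>f y\<bar> \<le> C"
  shows "(\<integral>y. f y \<partial>null_law (Suc t)) = (\<integral>y. (\<integral>u. f (y(Suc t := u)) \<partial>unif) \<partial>null_law t)"
proof -
  interpret unif: prob_space unif by (rule prob_space_unif)
  interpret product_sigma_finite "\<lambda>_::nat. unif" ..
  interpret N: prob_space "null_law (Suc t)" by (rule prob_space_null_law)
  have s: "{1..Suc t} = insert (Suc t) {1..t}" by auto
  have "integrable (null_law (Suc t)) f"
    by (rule N.integrable_const_bound[where B=C]) (auto simp: C)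
  then show ?thesis
    unfolding null_law_def s by (subst product_integral_insert) auto
qed

text \<open>Induction on \<open>t\<close>: the first \<open>t\<close> pivots are measurable in the
  history before token \<open>Suc t\<close>, so the one-step bound integrates out the last pivot and
  costs one factor. The induction hypothesis is then applied to a new test function, hence
  \<open>h\<close> and \<open>C\<close> are arbitrary.\<close>

lemma model_moment_le:
  fixes M :: "'a measure" and w :: "nat \<Rightarrow> 'a \<Rightarrow> 'w::finite" and h :: "(nat \<Rightarrow> real) \<Rightarrow> real"
  assumes model: "watermark_model M n e P xi w Z"
    and "t \<le> n"
    and h[measurable]: "h \<in> borel_measurable (PiM {1..t} (\<lambda>_. borel))" and hC: "\<And>y. \<bar>h y\<bar> \<le> C"
  shows "(\<integral>x. h (\<lambda>s\<in>{1..t}. xi s x (w s x)) \<partial>M)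
    \<le> sqrt (1 + (e * real CARD('w))\<^sup>2) ^ t * sqrt (\<integral>y. (h y)\<^sup>2 \<partial>null_law t)"
  using assms(2-)
proof (induction t arbitrary: h C)
  case 0
  interpret M: prob_space M by (rule model_prob_space[OF model])
  \<comment> \<open>With no tokens both laws are the point mass at the empty function, and the claim
    is that \<open>h\<close> is at most its absolute value there.\<close>
  show ?case
    by (simp add: null_law_def PiM_empty lebesgue_integral_count_space_finite restrict_def M.prob_space)
next
  case (Suc t)
  note [measurable] = Suc.prems(2)
  note hC = Suc.prems(3)
  have t: "Suc t \<in> {1..n}" using Suc.prems by auto
  interpret M: prob_space M by (rule model_prob_space[OF model])
  interpret unif: prob_space unif by (rule prob_space_unif)
  let ?F = "hist M P xi w (Suc t)"
  let ?a = "sqrt (1 + (e * real CARD('w))\<^sup>2)"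
  define X where "X x = (\<lambda>s\<in>{1..t}. xi s x (w s x))" for x
  \<comment> \<open>The L2 norm of \<open>h\<close> in the last coordinate is what
    \<open>model_step_le\<close> returns. Since \<open>g\<close> enters the induction hypothesis
    squared, Fubini recovers the second moment of \<open>h\<close> without further loss.\<close>
  define g where "g y = sqrt (\<integral>u. (h (y(Suc t := u)))\<^sup>2 \<partial>unif)" for y
  have s: "{1..Suc t} = insert (Suc t) {1..t}" by auto
  have C0: "0 \<le> C" using hC[of undefined] by linarith
  have hC2: "\<bar>(h y)\<^sup>2\<bar> \<le> C\<^sup>2" for y
    using hC[of y] by (metis abs_le_square_iff abs_of_nonneg C0 abs_power2)
  have h2: "(\<lambda>y. (h y)\<^sup>2) \<in> borel_measurable (PiM {1..Suc t} (\<lambda>_. borel))" by measurable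
  have X[measurable]: "X \<in> measurable ?F (PiM {1..t} (\<lambda>_. borel))"
    unfolding X_def
    by (intro measurable_restrict pivot_measurable[OF model] hist_measurable[OF model t]) auto
  have upd[measurable]: "(\<lambda>(y, u). y(Suc t := u)) \<in> measurable (PiM {1..t} (\<lambda>_. borel) \<Otimes>\<^sub>M borel) (PiM {1..Suc t} (\<lambda>_. borel :: real measure))"
    unfolding s by (rule measurable_add_dim)
  have hu[measurable]: "(\<lambda>(y, u). h (y(Suc t := u))) \<in> borel_measurable (PiM {1..t} (\<lambda>_. borel) \<Otimes>\<^sub>M borel)"
    using measurable_compose[OF upd Suc.prems(2)] by (simp only: split_beta')
  have [measurable]: "(\<lambda>(y, u). (h (y(Suc t := u)))\<^sup>2) \<in> borel_measurable (PiM {1..t} (\<lambda>_. borel) \<Otimes>\<^sub>M unif)"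
    using borel_measurable_power[OF hu, of 2] by (simp add: split_beta')
  have g[measurable]: "g \<in> borel_measurable (PiM {1..t} (\<lambda>_. borel))"
    unfolding g_def by measurable
  have g2: "(g y)\<^sup>2 = (\<integral>u. (h (y(Suc t := u)))\<^sup>2 \<partial>unif)" for y
    unfolding g_def by simp
  have gC: "\<bar>g y\<bar> \<le> C" for y
  proof -
    have "(\<integral>u. (h (y(Suc t := u)))\<^sup>2 \<partial>unif) \<le> (\<integral>u. C\<^sup>2 \<partial>unif)"
      using hC2 by (intro integral_mono') auto
    then have "(g y)\<^sup>2 \<le> C\<^sup>2" by (simp add: g2 unif.prob_space)
    then show ?thesis using C0 abs_le_square_iff[of "g y" C] by simp
  qed
  have eq: "(\<lambda>s\<in>{1..Suc t}. xi s x (w s x)) = (X x)(Suc t := xi (Suc t) x (w (Suc t) x))" for x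
    by (auto simp: X_def fun_eq_iff)
  have "(\<integral>x. h (\<lambda>s\<in>{1..Suc t}. xi s x (w s x)) \<partial>M)
      = (\<integral>x. (\<lambda>(x, u). h ((X x)(Suc t := u))) (x, xi (Suc t) x (w (Suc t) x)) \<partial>M)"
    unfolding eq by simp
  also have "\<dots> \<le> ?a * (\<integral>x. sqrt (\<integral>u. ((\<lambda>(x, u). h ((X x)(Suc t := u))) (x, u))\<^sup>2 \<partial>unif) \<partial>M)"
  proof (rule model_step_le[OF model t, where C=C])
    have "(\<lambda>p. (X (fst p), snd p)) \<in> measurable (?F \<Otimes>\<^sub>M borel) (PiM {1..t} (\<lambda>_. borel) \<Otimes>\<^sub>M (borel :: real measure))"
      by measurable
    from measurable_compose[OF this hu]
    show "(\<lambda>(x, u). h ((X x)(Suc t := u))) \<in> borel_measurable (?F \<Otimes>\<^sub>M borel)"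
      by (simp add: split_beta')
  qed (auto simp: hC)
  also have "\<dots> = ?a * (\<integral>x. g (X x) \<partial>M)"
    by (simp add: g_def)
  also have "\<dots> \<le> ?a * (?a ^ t * sqrt (\<integral>y. (g y)\<^sup>2 \<partial>null_law t))"
    unfolding X_def using Suc.prems(1) by (intro mult_left_mono Suc.IH[OF _ g gC]) auto
  also have "(\<integral>y. (g y)\<^sup>2 \<partial>null_law t) = (\<integral>y. (h y)\<^sup>2 \<partial>null_law (Suc t))"
    unfolding g2 by (rule null_law_Suc[OF h2 hC2, symmetric])
  finally show ?case by (simp add: mult.assoc)
qed

section \<open>From second moments to total variation\<close>

text \<open>The test function \<open>1 + s * (indicator A - q)\<close> has null mean 1 and null
  second moment at most \<open>1 + s\<^sup>2\<close>, while its mean under the model is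
  \<open>1 + s * (r - q)\<close>. The moment bound compares these for every real \<open>s\<close>,
  and a suitable \<open>s\<close> of either sign bounds the difference from both sides.\<close>

lemma pivot_law_diff_le:
  fixes M :: "'a measure" and w :: "nat \<Rightarrow> 'a \<Rightarrow> 'w::finite"
  assumes model: "watermark_model M n e P xi w Z" and "e \<noteq> 0" "1 \<le> n"
    and A: "A \<in> sets (PiM {1..n} (\<lambda>_. borel))"
  shows "\<bar>measure (null_law n) A - measure (pivot_law M n xi w) A\<bar>
    \<le> sqrt (exp (real n * (e * real CARD('w))\<^sup>2) - 1)"
proof -
  interpret M: prob_space M by (rule model_prob_space[OF model])
  interpret N: prob_space "null_law n" by (rule prob_space_null_law)
  define E where "E = exp (real n * (e * real CARD('w))\<^sup>2)"
  define q where "q = measure (null_law n) A"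
  define r where "r = measure (pivot_law M n xi w) A"
  \<comment> \<open>Strictness makes the later choice of \<open>s\<close> positive, so that one can
    divide by it; this uses \<open>e \<noteq> 0\<close> and \<open>1 \<le> n\<close>.\<close>
  have E1: "1 < E" unfolding E_def using assms by simp
  have A'[measurable]: "A \<in> sets (null_law n)" using A by (simp add: sets_null_law)
  have q01: "0 \<le> q" "q \<le> 1" unfolding q_def by auto
  have Y[measurable]: "(\<lambda>x. \<lambda>t\<in>{1..n}. xi t x (w t x)) \<in> measurable M (PiM {1..n} (\<lambda>_. borel))"
    by (intro measurable_restrict pivot_measurable[OF model] model_measurable[OF model])
  have rM: "r = (\<integral>x. indicator A (\<lambda>t\<in>{1..n}. xi t x (w t x)) \<partial>M)"
    unfolding r_def pivot_law_def using A
    by (subst integral_distr[OF Y, symmetric]) auto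
  have iA: "integrable M (\<lambda>x. indicat_real A (\<lambda>t\<in>{1..n}. xi t x (w t x)))"
    by (intro M.integrable_const_bound[where B=1] measurable_compose[OF Y borel_measurable_indicator[OF A]]) auto
  have iN: "integrable (null_law n) (indicat_real A)"
    by (rule N.integrable_const_bound[where B=1]) auto
  have key: "1 + s * (r - q) \<le> sqrt (E * (1 + s\<^sup>2))" for s
  proof -
    define h where "h y = 1 + s * (indicat_real A y - q)" for y
    have h[measurable]: "h \<in> borel_measurable (PiM {1..n} (\<lambda>_. borel))"
      unfolding h_def using A by measurable
    have hC: "\<bar>h y\<bar> \<le> 1 + \<bar>s\<bar>" for y
    proof -
      have "\<bar>indicat_real A y - q\<bar> \<le> 1" using q01 by (auto simp: indicator_def)
      then have "\<bar>s * (indicat_real A y - q)\<bar> \<le> \<bar>s\<bar>" by (simp add: abs_mult mult_left_le)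
      then show ?thesis unfolding h_def by linarith
    qed
    have "1 + s * (r - q) = (\<integral>x. h (\<lambda>t\<in>{1..n}. xi t x (w t x)) \<partial>M)"
      unfolding h_def using iA by (simp add: rM M.prob_space)
    also have "\<dots> \<le> sqrt (1 + (e * real CARD('w))\<^sup>2) ^ n * sqrt (\<integral>y. (h y)\<^sup>2 \<partial>null_law n)"
      by (rule model_moment_le[OF model _ h hC]) simp
    also have "\<dots> = sqrt ((1 + (e * real CARD('w))\<^sup>2) ^ n * (\<integral>y. (h y)\<^sup>2 \<partial>null_law n))"
      by (simp add: real_sqrt_mult real_sqrt_power)
    also have "\<dots> \<le> sqrt (E * (1 + s\<^sup>2))"
    proof (intro real_sqrt_le_mono mult_mono)
      have "(1 + (e * real CARD('w))\<^sup>2) ^ n \<le> exp ((e * real CARD('w))\<^sup>2) ^ n"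
        by (intro power_mono exp_ge_add_one_self) auto
      then show "(1 + (e * real CARD('w))\<^sup>2) ^ n \<le> E"
        by (simp add: E_def exp_of_nat_mult)
      \<comment> \<open>An indicator equals its own square, so the square of \<open>h\<close> is
        affine in it and its null mean depends on \<open>q\<close> alone.\<close>
      have "(h y)\<^sup>2 = (1 - s * q)\<^sup>2 + (2 * s * (1 - s * q) + s\<^sup>2) * indicat_real A y" for y
        unfolding h_def by (cases "y \<in> A") (auto simp: power2_eq_square algebra_simps)
      then have "(\<integral>y. (h y)\<^sup>2 \<partial>null_law n) = (1 - s * q)\<^sup>2 + (2 * s * (1 - s * q) + s\<^sup>2) * q"
        using N.prob_space iN by (simp add: q_def sets.Int_space_eq2)
      also have "\<dots> = 1 + s\<^sup>2 * (q * (1 - q))"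
        by (simp add: power2_eq_square algebra_simps)
      also have "\<dots> \<le> 1 + s\<^sup>2"
        using q01 mult_left_le[of "q * (1 - q)" "s\<^sup>2"] mult_le_one[of q "1 - q"] by auto
      finally show "(\<integral>y. (h y)\<^sup>2 \<partial>null_law n) \<le> 1 + s\<^sup>2" .
    qed (use E1 in auto)
    finally show ?thesis .
  qed
  \<comment> \<open>For \<open>s\<^sup>2 = E - 1\<close> the bound in \<open>key\<close> is exactly \<open>E = 1 + s\<^sup>2\<close>.\<close>
  define s where "s = sqrt (E - 1)"
  have s: "0 < s" "s\<^sup>2 = E - 1" using E1 by (auto simp: s_def)
  have b: "sqrt (E * (1 + s\<^sup>2)) = E" using E1 by (simp add: s(2) flip: power2_eq_square)
  \<comment> \<open>The value \<open>s\<close> bounds \<open>r - q\<close>, the value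
    \<open>- s\<close> bounds \<open>q - r\<close>; in both cases the right side of
    \<open>key\<close> is \<open>1 + s * s\<close>.\<close>
  have "s * (r - q) \<le> s * s" "s * (q - r) \<le> s * s"
    using key[of s] key[of "- s"] b s(2) by (simp_all add: power2_eq_square algebra_simps)
  then have "\<bar>q - r\<bar> \<le> s" using s(1) by auto
  then show ?thesis by (simp add: q_def r_def s_def E_def)
qed

section \<open>Asymptotics as the text length grows\<close>

text \<open>The bound of \<open>pivot_law_diff_le\<close> does not depend on the event, so it passes
  to the supremum and also applies to rejection regions \<open>R n\<close> that vary with
  \<open>n\<close>.\<close>

theorem theorem4p1:
  fixes eps :: "nat \<Rightarrow> real" and p :: real
    and M :: "nat \<Rightarrow> 'a measure"
    and P :: "nat \<Rightarrow> nat \<Rightarrow> 'a \<Rightarrow> 'w::finite \<Rightarrow> real"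
    and xi :: "nat \<Rightarrow> nat \<Rightarrow> 'a \<Rightarrow> 'w \<Rightarrow> real"
    and w :: "nat \<Rightarrow> nat \<Rightarrow> 'a \<Rightarrow> 'w"
    and Z :: "nat \<Rightarrow> nat \<Rightarrow> 'a \<Rightarrow> bool"
  assumes p: "1/2 < p" "p \<le> 1"
    and eps_rate: "\<exists>C1 C2. C1 > 0 \<and> C2 > 0 \<and>
        (\<forall>n\<ge>1. C1 * real n powr (-p) \<le> eps n \<and> eps n \<le> C2 * real n powr (-p))"
    and model: "\<And>n. watermark_model (M n) n (eps n) (P n) (xi n) (w n) (Z n)"
  shows "(\<lambda>n. tv_dist (null_law n) (pivot_law (M n) n (xi n) (w n))) \<longlonglongrightarrow> 0 \<and>
        (\<forall>R. (\<forall>n. R n \<in> sets (PiM {1..n} (\<lambda>_. borel))) \<longrightarrow>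
          (\<lambda>n. measure (null_law n) (R n) + (1 - measure (pivot_law (M n) n (xi n) (w n)) (R n)))
            \<longlonglongrightarrow> 1)"
proof -
  obtain C1 C2 where C: "C1 > 0" "C2 > 0"
    "\<And>n. n \<ge> 1 \<Longrightarrow> C1 * real n powr (-p) \<le> eps n" "\<And>n. n \<ge> 1 \<Longrightarrow> eps n \<le> C2 * real n powr (-p)"
    using eps_rate by blast
  define K where "K = real CARD('w)"
  define b where "b n = sqrt (exp (real n * (eps n * K)\<^sup>2) - 1)" for n
  \<comment> \<open>The lower half of the rate supplies the nonzero fraction that
    \<open>pivot_law_diff_le\<close> asks for.\<close>
  have pos: "0 < eps n" if "n \<ge> 1" for n
    using C(1) C(3)[OF that] that by (smt (verit) mult_pos_pos powr_gt_zero of_nat_0_less_iff less_le_trans zero_less_one)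
  have diff: "\<bar>measure (null_law n) A - measure (pivot_law (M n) n (xi n) (w n)) A\<bar> \<le> b n"
    if "n \<ge> 1" "A \<in> sets (PiM {1..n} (\<lambda>_. borel))" for n A
    unfolding b_def K_def by (rule pivot_law_diff_le[OF model]) (use that pos[of n] in auto)
  have rate: "(\<lambda>n. real n * (eps n * K)\<^sup>2) \<longlonglongrightarrow> 0"
  proof (rule tendsto_sandwich[OF _ _ tendsto_const])
    show "\<forall>\<^sub>F n in sequentially. 0 \<le> real n * (eps n * K)\<^sup>2" by simp
    show "\<forall>\<^sub>F n in sequentially. real n * (eps n * K)\<^sup>2 \<le> (C2 * K)\<^sup>2 * real n powr (1 - 2 * p)"
      using eventually_ge_at_top[of 1]
    proof eventually_elim
      case (elim n)
      have "(eps n)\<^sup>2 \<le> (C2 * real n powr (-p))\<^sup>2"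
        using C(4)[OF elim] pos[OF elim] by (intro power_mono) auto
      also have "\<dots> = C2\<^sup>2 * real n powr (- 2 * p)"
        by (simp add: power_mult_distrib power2_eq_square flip: powr_add)
      finally have "real n * (eps n * K)\<^sup>2 \<le> real n * (C2\<^sup>2 * real n powr (- 2 * p) * K\<^sup>2)"
        by (simp add: power_mult_distrib mult_left_mono mult_right_mono)
      also have "real n * real n powr (- 2 * p) = real n powr (1 - 2 * p)"
        using elim powr_add[of "real n" 1 "- 2 * p"] by simp
      then have "real n * (C2\<^sup>2 * real n powr (- 2 * p) * K\<^sup>2) = (C2 * K)\<^sup>2 * real n powr (1 - 2 * p)"
        by (simp add: power_mult_distrib mult.commute mult.left_commute)
      finally show ?case .
    qed
    \<comment> \<open>The threshold enters here: the exponent is negative because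
      \<open>p > 1/2\<close>.\<close>
    have "(\<lambda>n. real n powr (1 - 2 * p)) \<longlonglongrightarrow> 0"
      using p by (intro tendsto_neg_powr filterlim_real_sequentially) auto
    from tendsto_mult_right_zero[OF this]
    show "(\<lambda>n. (C2 * K)\<^sup>2 * real n powr (1 - 2 * p)) \<longlonglongrightarrow> 0" .
  qed
  have b0: "b \<longlonglongrightarrow> 0"
    unfolding b_def by (rule tendsto_eq_intros rate refl | simp)+
  have "(\<lambda>n. tv_dist (null_law n) (pivot_law (M n) n (xi n) (w n))) \<longlonglongrightarrow> 0"
  proof (rule tendsto_sandwich[OF _ _ tendsto_const b0])
    have bnd: "0 \<le> tv_dist (null_law n) (pivot_law (M n) n (xi n) (w n)) \<and>
        tv_dist (null_law n) (pivot_law (M n) n (xi n) (w n)) \<le> b n" if "n \<ge> 1" for n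
    proof -
      let ?d = "\<lambda>A. \<bar>measure (null_law n) A - measure (pivot_law (M n) n (xi n) (w n)) A\<bar>"
      have le: "?d A \<le> b n" if "A \<in> sets (null_law n)" for A
        using diff[OF \<open>n \<ge> 1\<close>] that by (simp add: sets_null_law)
      \<comment> \<open>The empty set has difference 0, which makes the supremum nonnegative;
        \<open>le\<close> provides the boundedness that a conditionally complete supremum
        requires.\<close>
      have "?d {} \<le> (SUP A\<in>sets (null_law n). ?d A)"
        by (rule cSUP_upper) (use le in \<open>auto intro!: bdd_aboveI2[where M="b n"]\<close>)
      moreover have "(SUP A\<in>sets (null_law n). ?d A) \<le> b n"
        by (rule cSUP_least) (use le in auto)
      ultimately show ?thesis by (simp add: tv_dist_def)
    qed
    show "\<forall>\<^sub>F n in sequentially. 0 \<le> tv_dist (null_law n) (pivot_law (M n) n (xi n) (w n))"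
      "\<forall>\<^sub>F n in sequentially. tv_dist (null_law n) (pivot_law (M n) n (xi n) (w n)) \<le> b n"
      using bnd by (auto intro!: eventually_sequentiallyI[of 1])
  qed
  moreover have "(\<lambda>n. measure (null_law n) (R n) + (1 - measure (pivot_law (M n) n (xi n) (w n)) (R n))) \<longlonglongrightarrow> 1"
    if R: "\<And>n. R n \<in> sets (PiM {1..n} (\<lambda>_. borel))" for R
  proof -
    \<comment> \<open>The sum of the two errors is 1 plus this difference, whose absolute value is
      at most \<open>b n\<close>.\<close>
    have "(\<lambda>n. measure (null_law n) (R n) - measure (pivot_law (M n) n (xi n) (w n)) (R n)) \<longlonglongrightarrow> 0"
      using diff[OF _ R] by (intro Lim_null_comparison[OF _ b0] eventually_sequentiallyI[of 1]) auto
    from tendsto_add[OF this tendsto_const[of 1]] show ?thesis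
      by (simp add: algebra_simps)
  qed
  ultimately show ?thesis by blast
qed

end
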